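(* For every positive integer $k$, let $G_{2k+1}$ be the Goldberg snark of order $8(2k+1)$. Then $$\Phi_c(G_{2k+1})\le 4+\frac{1}{k+1}.$$
   Context: For a real number $r\ge 2$, a circular nowhere-zero $r$-flow in a graph $G=(V,E)$ is an orientation of $G$ together with a function $f\colon E\to[1,r-1]$ such that at every vertex the sum of the values of incoming edges equals the sum of the values of outgoing edges. The circular flow number $\Phi_c(G)$ of a bridgeless graph $G$ is the least real $r$ such that $G$ admits a circular nowhere-zero $r$-flow (this minimum exists). The Goldberg snark $G_{2k+1}$ is the cubic graph obtained by cyclically gluing $2k+1$ copies of the Petersen graph minus two vertices at distance $2$. Explicitly, for each $t\in\mathbb{Z}/(2k+1)\mathbb{Z}$ take a block $P^-_t$ with eight vertices $z^t,w^t,w_1^t,w_2^t,x_1^t,x_2^t,y_1^t,y_2^t$ and the nine edges $$z^tw^t,\quad w^tw_1^t,\quad w^tw_2^t,\quad x_1^ty_1^t,\quad y_1^tw_1^t,\quad w_1^tx_2^t,\quad x_2^ty_2^t,\quad y_2^tw_2^t,\quad w_2^tx_1^t$$ (this is the Petersen graph minus two vertices $x,y$ at distance $2$, where $z$ is the common neighbour of $x$ and $y$, $x_1,x_2$ are the other neighbours of $x$, and $y_1,y_2$ are the other neighbours of $y$). Consecutive blocks $P^-_t$ and $P^-_{t+1}$ are joined by the three edges $z^tz^{t+1}$, $y_1^tx_1^{t+1}$, $y_2^tx_2^{t+1}$, with indices $t$ taken modulo $2k+1$. *)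

theory Defs
  imports "HOL-Analysis.Analysis"
begin

text \<open>
  Graphs are simple and undirected: an edge is the two-element set of its ends.
\<close>

record 'a graph =
  verts :: "'a set"
  edges :: "'a set set"

definition fin_simple_graph :: "('a, 'm) graph_scheme \<Rightarrow> bool" where
  "fin_simple_graph G \<longleftrightarrow>
     finite (verts G) \<and> (\<forall>e\<in>edges G. e \<subseteq> verts G \<and> card e = 2)"

text \<open>
  An orientation is a set of arcs (tail, head) that contains exactly one of the two arcs
  over every edge.
\<close>

definition orientation :: "('a, 'm) graph_scheme \<Rightarrow> ('a \<times> 'a) set \<Rightarrow> bool" where
  "orientation G D \<longleftrightarrow>
     D \<subseteq> verts G \<times> verts G \<and> bij_betw (\<lambda>(u, v). {u, v}) D (edges G)"

text \<open>The values of \<open>f\<close> outside \<open>edges G\<close> are irrelevant.\<close>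

definition circular_nz_flow ::
  "('a, 'm) graph_scheme \<Rightarrow> real \<Rightarrow> ('a \<times> 'a) set \<Rightarrow> ('a set \<Rightarrow> real) \<Rightarrow> bool" where
  "circular_nz_flow G r D f \<longleftrightarrow>
     orientation G D \<and>
     (\<forall>e\<in>edges G. f e \<in> {1..r - 1}) \<and>
     (\<forall>v\<in>verts G. (\<Sum>u | (u, v) \<in> D. f {u, v}) = (\<Sum>w | (v, w) \<in> D. f {v, w}))"

definition has_circular_nz_flow :: "('a, 'm) graph_scheme \<Rightarrow> real \<Rightarrow> bool" where
  "has_circular_nz_flow G r \<longleftrightarrow> 2 \<le> r \<and> (\<exists>D f. circular_nz_flow G r D f)"

text \<open>
  This is a genuine minimum, not an infimum: a bound on it is provable only where the
  minimum is shown to exist. The value is unspecified for a graph without any circular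
  nowhere-zero flow (one with a bridge).
\<close>

definition circular_flow_number :: "('a, 'm) graph_scheme \<Rightarrow> real" where
  "circular_flow_number G = (LEAST r. has_circular_nz_flow G r)"

datatype block_vertex = Z | W | W1 | W2 | X1 | X2 | Y1 | Y2

definition block_edges :: "block_vertex set set" where
  "block_edges =
     {{Z, W}, {W, W1}, {W, W2}, {X1, Y1}, {Y1, W1}, {W1, X2}, {X2, Y2}, {Y2, W2}, {W2, X1}}"

text \<open>
  \<open>goldberg_snark k\<close> is the graph $G_{2k+1}$. The vertex \<open>(t, b)\<close> is the vertex
  \<open>b\<close> of block \<open>t\<close>, where \<open>t\<close> is the representative in \<open>{0..<2 * k + 1}\<close> of an
  element of $\mathbb{Z}/(2k+1)\mathbb{Z}$.
\<close>

definition goldberg_snark :: "nat \<Rightarrow> (nat \<times> block_vertex) graph" where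
  "goldberg_snark k =
     \<lparr>verts = {0..<2 * k + 1} \<times> UNIV,
      edges =
        (\<Union>t\<in>{0..<2 * k + 1}. (\<lambda>e. Pair t ` e) ` block_edges) \<union>
        (\<Union>t\<in>{0..<2 * k + 1}.
           let s = (t + 1) mod (2 * k + 1)
           in {{(t, Z), (s, Z)}, {(t, Y1), (s, X1)}, {(t, Y2), (s, X2)}})\<rparr>"

lemma UNIV_block_vertex: "UNIV = {Z, W, W1, W2, X1, X2, Y1, Y2}"
  using block_vertex.exhaust by auto

lemma order_goldberg_snark: "card (verts (goldberg_snark k)) = 8 * (2 * k + 1)"
  by (simp add: goldberg_snark_def card_cartesian_product UNIV_block_vertex)

lemma goldberg_succ_neq:
  fixes k t :: nat
  assumes "1 \<le> k" "t < 2 * k + 1"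
  shows "(t + 1) mod (2 * k + 1) \<noteq> t"
  using assms by (cases "t = 2 * k") auto

lemma fin_simple_goldberg_snark:
  assumes "1 \<le> k"
  shows "fin_simple_graph (goldberg_snark k)"
  using goldberg_succ_neq[OF assms] unfolding fin_simple_graph_def
proof (intro conjI)
  show "finite (verts (goldberg_snark k))"
    by (simp add: goldberg_snark_def UNIV_block_vertex)
next
  have "Pair t ` e \<subseteq> {0..<2 * k + 1} \<times> UNIV \<and> card (Pair t ` e) = 2"
    if "t < 2 * k + 1" "e \<in> block_edges" for t e
    using that by (auto simp: block_edges_def)
  moreover have "e \<subseteq> {0..<2 * k + 1} \<times> UNIV \<and> card e = 2"
    if "t < 2 * k + 1" "s = (t + 1) mod (2 * k + 1)"
       "e \<in> {{(t, Z), (s, Z)}, {(t, Y1), (s, X1)}, {(t, Y2), (s, X2)}}" for t s e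
    using that goldberg_succ_neq[OF assms that(1)] by (auto simp: card_insert_if)
  ultimately show "\<forall>e\<in>edges (goldberg_snark k). e \<subseteq> verts (goldberg_snark k) \<and> card e = 2"
    unfolding goldberg_snark_def Let_def by (auto simp del: One_nat_def)
qed

end

theory Submission
  imports Defs
begin

text \<open>
  A bound on the flow number needs the minimum to exist: for each of the finitely many
  orientations, the pairs of a value \<open>r\<close> in a bounded interval and an \<open>r\<close>-flow form a compact
  set, on which \<open>r\<close> attains its minimum.

  Put \<open>n = k + 1\<close>. On the reference orientation of \<open>goldberg_arcs\<close> we give a signed integer flow
  whose values have modulus in \<open>[n, 3n + 1]\<close>; reversing the arcs with negative value and
  dividing by \<open>n\<close> gives the required flow. Along two consecutive blocks the flow is affine in
  \<open>j = (t + 1) div 2\<close>: with every such pair the values on the three edges leaving an even block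
  drift by \<open>(1, -1, 0)\<close>, those on the edges leaving an odd block by \<open>(1, 0, -1)\<close>. Blocks
  \<open>0\<close>, \<open>1\<close>, \<open>2\<close> are different and absorb the total drift, so that the flow closes up around the
  cycle. The pattern was found by computer search.
\<close>

section \<open>Existence of the minimum\<close>

text \<open>Tychonoff's theorem for the product topology on a full function space, in which the flow
  values live.\<close>

lemma compact_Pi_UNIV:
  fixes S :: "'a \<Rightarrow> 'b::topological_space set"
  assumes "\<And>i. compact (S i)"
  shows "compact (Pi UNIV S)"
  using assms
  by (metis PiE_UNIV_domain compactin_PiE compactin_euclidean_iff euclidean_product_topology)

lemma continuous_on_app_snd [continuous_intros]:
  fixes e :: 'e
  shows "continuous_on A (\<lambda>p :: 'c::topological_space \<times> ('e \<Rightarrow> 'b::topological_space). snd p e)"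
  by (rule continuous_on_compose2[OF continuous_on_product_coordinates continuous_on_snd])
    (auto intro: continuous_on_id)

text \<open>Every arc of \<open>D\<close> lies over an edge, so only values on edges enter the sums.
  This permits resetting a flow to 0 off the edges.\<close>

lemma circular_nz_flow_cong:
  assumes "circular_nz_flow G r D f" "\<And>e. e \<in> edges G \<Longrightarrow> f e = g e"
  shows "circular_nz_flow G r D g"
proof -
  have arc: "{u, v} \<in> edges G" if "(u, v) \<in> D" for u v
    using assms(1) that unfolding circular_nz_flow_def orientation_def bij_betw_def by auto
  have "(\<Sum>u | (u, v) \<in> D. f {u, v}) = (\<Sum>u | (u, v) \<in> D. g {u, v})"
    "(\<Sum>w | (v, w) \<in> D. f {v, w}) = (\<Sum>w | (v, w) \<in> D. g {v, w})" for v
    using arc assms(2) by (auto intro!: sum.cong)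
  then show ?thesis
    using assms unfolding circular_nz_flow_def by auto
qed

lemma has_circular_nz_flow_minimum:
  assumes fin: "finite (verts G)" "finite (edges G)" and R: "has_circular_nz_flow G R"
  obtains r where "has_circular_nz_flow G r" "\<And>s. has_circular_nz_flow G s \<Longrightarrow> r \<le> s"
proof -
  \<comment> \<open>Off the edges the values are pinned to 0: left free, they would make the set of
    flows non-compact.\<close>
  define S where "S = (\<lambda>e. if e \<in> edges G then {1..R - 1} else {0::real})"
  define K where "K = (\<lambda>D. {p. fst p \<in> {2..R} \<and> snd p \<in> Pi UNIV S \<and>
    circular_nz_flow G (fst p) D (snd p)})"
  define Ds where "Ds = {D. orientation G D}"
  have "finite Ds"
    by (rule finite_subset[of _ "Pow (verts G \<times> verts G)"])
      (use fin in \<open>auto simp: Ds_def orientation_def\<close>)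
  moreover have "compact (K D)" if "D \<in> Ds" for D
  proof -
    \<comment> \<open>With \<open>D\<close> fixed, all conditions are closed in the pair of
      \<open>r\<close> and the flow. The upper bound \<open>r - 1\<close> moves with
      \<open>r\<close>, so it is imposed jointly on top of the fixed compact box.\<close>
    have "K D = ({2..R} \<times> Pi UNIV S) \<inter> (\<Inter>e\<in>edges G. {p. 1 \<le> snd p e \<and> snd p e \<le> fst p - 1}) \<inter>
        (\<Inter>v\<in>verts G. {p. (\<Sum>u | (u, v) \<in> D. snd p {u, v}) = (\<Sum>w | (v, w) \<in> D. snd p {v, w})})"
      using that by (auto simp: K_def circular_nz_flow_def Ds_def)
    also have "compact \<dots>"
    proof (intro compact_Int_closed compact_Times compact_Pi_UNIV closed_INT ballI)
      show "compact (S e)" for e by (auto simp: S_def)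
      show "closed {p :: real \<times> ('a set \<Rightarrow> real). 1 \<le> snd p e \<and> snd p e \<le> fst p - 1}" for e
        by (intro closed_Collect_conj closed_Collect_le continuous_intros)
      show "closed {p :: real \<times> ('a set \<Rightarrow> real).
          (\<Sum>u | (u, v) \<in> D. snd p {u, v}) = (\<Sum>w | (v, w) \<in> D. snd p {v, w})}" for v
        by (intro closed_Collect_eq continuous_intros)
    qed auto
    finally show ?thesis .
  qed
  ultimately have "compact (\<Union>D\<in>Ds. K D)"
    by (intro compact_UN) auto
  moreover have in_K: "\<exists>p. p \<in> (\<Union>D\<in>Ds. K D) \<and> fst p = s"
    if s: "has_circular_nz_flow G s" "s \<le> R" for s
  proof -
    obtain D f where f: "circular_nz_flow G s D f" and "2 \<le> s"
      using s by (auto simp: has_circular_nz_flow_def)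
    define g where "g = (\<lambda>e. if e \<in> edges G then f e else 0)"
    have "circular_nz_flow G s D g"
      using f by (rule circular_nz_flow_cong) (simp add: g_def)
    moreover have "g \<in> Pi UNIV S"
      using f s(2) by (fastforce simp: g_def S_def circular_nz_flow_def)
    ultimately show ?thesis
      using \<open>2 \<le> s\<close> s(2)
      by (intro exI[of _ "(s, g)"]) (auto simp: K_def Ds_def circular_nz_flow_def)
  qed
  moreover have "(\<Union>D\<in>Ds. K D) \<noteq> {}"
    using in_K[OF R] by auto
  ultimately obtain p where p: "p \<in> (\<Union>D\<in>Ds. K D)"
    and min: "\<And>q. q \<in> (\<Union>D\<in>Ds. K D) \<Longrightarrow> fst p \<le> fst q"
    using continuous_attains_inf[of "\<Union>D\<in>Ds. K D" fst]
      continuous_on_fst[OF continuous_on_id] by meson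
  show ?thesis
  proof
    show "has_circular_nz_flow G (fst p)"
      using p by (auto simp: K_def has_circular_nz_flow_def)
    show "fst p \<le> s" if "has_circular_nz_flow G s" for s
    proof (cases "s \<le> R")
      case True
      then show ?thesis using in_K[OF that] min by metis
    next
      case False
      then show ?thesis using p by (auto simp: K_def)
    qed
  qed
qed

lemma circular_flow_number_le:
  assumes "fin_simple_graph G" "has_circular_nz_flow G R"
  shows "circular_flow_number G \<le> R"
proof -
  have "edges G \<subseteq> Pow (verts G)" and "finite (verts G)"
    using assms(1) by (auto simp: fin_simple_graph_def)
  then have "finite (edges G)"
    by (meson finite_Pow_iff finite_subset)
  then obtain r where r: "has_circular_nz_flow G r" "\<And>s. has_circular_nz_flow G s \<Longrightarrow> r \<le> s"
    using has_circular_nz_flow_minimum[OF \<open>finite (verts G)\<close> _ assms(2)] by blast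
  then have "circular_flow_number G = r"
    unfolding circular_flow_number_def by (intro Least_equality)
  then show ?thesis using r(2)[OF assms(2)] by simp
qed

section \<open>Signed flows\<close>

text \<open>Reversing an arc of negative value moves its term to the other side of the balance
  equation with the opposite sign, so conservation survives.\<close>

lemma has_circular_nz_flow_signed:
  fixes \<phi> :: "'a \<times> 'a \<Rightarrow> real"
  assumes fin: "finite (verts G)" and D: "orientation G D" and r: "2 \<le> r"
    and range: "\<And>a. a \<in> D \<Longrightarrow> 1 \<le> \<bar>\<phi> a\<bar> \<and> \<bar>\<phi> a\<bar> \<le> r - 1"
    and bal: "\<And>v. v \<in> verts G \<Longrightarrow> (\<Sum>u | (u, v) \<in> D. \<phi> (u, v)) = (\<Sum>w | (v, w) \<in> D. \<phi> (v, w))"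
  shows "has_circular_nz_flow G r"
proof -
  let ?E = "\<lambda>(u, v). {u, v}"
  \<comment> \<open>\<open>inv_into\<close> recovers the unique arc of \<open>D\<close> over an
    edge; the modulus is the same for both directions.\<close>
  define f where "f = (\<lambda>e. \<bar>\<phi> (inv_into D ?E e)\<bar>)"
  define D' where "D' = {(u, v). (u, v) \<in> D \<and> 0 < \<phi> (u, v) \<or> (v, u) \<in> D \<and> \<phi> (v, u) < 0}"
  have DV: "D \<subseteq> verts G \<times> verts G" and inj: "inj_on ?E D" and img: "?E ` D = edges G"
    using D by (auto simp: orientation_def bij_betw_def)
  have f: "f {u, v} = \<bar>\<phi> (u, v)\<bar>" "f {v, u} = \<bar>\<phi> (u, v)\<bar>" if "(u, v) \<in> D" for u v
    using inv_into_f_f[OF inj that] by (auto simp: f_def insert_commute)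
  have asym: "u = v" if "(u, v) \<in> D" "(v, u) \<in> D" for u v
  proof -
    have "(u, v) = (v, u)"
      by (rule inj_onD[OF inj _ that]) (simp add: insert_commute)
    then show ?thesis by (elim Pair_inject)
  qed
  have opposite: False if "(u, v) \<in> D" "(v, u) \<in> D" "0 < \<phi> (u, v)" "\<phi> (v, u) < 0" for u v
    using that asym[OF that(1,2)] by auto
  have "inj_on ?E D'"
  proof (rule inj_onI, clarify)
    fix u v u' v' assume *: "(u, v) \<in> D'" "(u', v') \<in> D'" "{u, v} = {u', v'}"
    have "u = v" if "(u, v) \<in> D'" "(v, u) \<in> D'"
      using that asym[of u v] by (auto simp: D'_def)
    then have "\<not> (u = v' \<and> v = u' \<and> u \<noteq> v)"
      using *(1,2) by blast
    then show "u = u' \<and> v = v'"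
      using *(3) by (auto simp: doubleton_eq_iff)
  qed
  moreover have "?E ` D' = edges G"
  proof -
    have 1: "{u, v} \<in> ?E ` D'" if "(u, v) \<in> D" for u v
    proof (cases "0 < \<phi> (u, v)")
      case True
      then show ?thesis using that by (intro image_eqI[of _ _ "(u, v)"]) (auto simp: D'_def)
    next
      case False
      then have "\<phi> (u, v) < 0" using range[OF that] by auto
      then show ?thesis using that by (intro image_eqI[of _ _ "(v, u)"]) (auto simp: D'_def)
    qed
    have 2: "{u, v} \<in> ?E ` D" if "(u, v) \<in> D'" for u v
    proof (cases "(u, v) \<in> D")
      case True
      then show ?thesis by (intro image_eqI[of _ _ "(u, v)"]) simp_all
    next
      case False
      then show ?thesis
        using that by (intro image_eqI[of _ _ "(v, u)"]) (auto simp: D'_def)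
    qed
    show ?thesis
      unfolding img[symmetric]
      by (intro equalityI image_subsetI; clarify; simp only: prod.case 1 2)
  qed
  ultimately have "orientation G D'"
    using DV by (auto simp: orientation_def bij_betw_def D'_def)
  moreover have "f e \<in> {1..r - 1}" if "e \<in> edges G" for e
    using that range f unfolding img[symmetric] by auto
  moreover have "(\<Sum>u | (u, v) \<in> D'. f {u, v}) = (\<Sum>w | (v, w) \<in> D'. f {v, w})"
    if v: "v \<in> verts G" for v
  proof -
    let ?I = "{u. (u, v) \<in> D}" and ?O = "{w. (v, w) \<in> D}"
    have [simp]: "finite ?I" "finite ?O"
      using DV by (auto intro: finite_subset[OF _ fin])
    \<comment> \<open>Positive and negative parts of the in- and out-sums. Reversal regroups
      \<open>?pI - ?nI = ?pO - ?nO\<close> as \<open>?pI + ?nO = ?pO + ?nI\<close>.\<close>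
    let ?pI = "\<Sum>u\<in>?I. if 0 < \<phi> (u, v) then \<phi> (u, v) else 0"
    let ?nI = "\<Sum>u\<in>?I. if \<phi> (u, v) < 0 then - \<phi> (u, v) else 0"
    let ?pO = "\<Sum>w\<in>?O. if 0 < \<phi> (v, w) then \<phi> (v, w) else 0"
    let ?nO = "\<Sum>w\<in>?O. if \<phi> (v, w) < 0 then - \<phi> (v, w) else 0"
    have "{u. (u, v) \<in> D'} = {u\<in>?I. 0 < \<phi> (u, v)} \<union> {u\<in>?O. \<phi> (v, u) < 0}"
      by (auto simp: D'_def)
    moreover have "{u\<in>?I. 0 < \<phi> (u, v)} \<inter> {u\<in>?O. \<phi> (v, u) < 0} = {}"
      using opposite by blast
    moreover have "(\<Sum>u\<in>{u\<in>?I. 0 < \<phi> (u, v)}. f {u, v}) = ?pI"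
      by (subst sum.inter_filter) (auto simp: f intro!: sum.cong)
    moreover have "(\<Sum>u\<in>{u\<in>?O. \<phi> (v, u) < 0}. f {u, v}) = ?nO"
      by (subst sum.inter_filter) (auto simp: f intro!: sum.cong)
    ultimately have 1: "(\<Sum>u | (u, v) \<in> D'. f {u, v}) = ?pI + ?nO"
      by (simp add: sum.union_disjoint)
    have "{w. (v, w) \<in> D'} = {u\<in>?O. 0 < \<phi> (v, u)} \<union> {u\<in>?I. \<phi> (u, v) < 0}"
      by (auto simp: D'_def)
    moreover have "{u\<in>?O. 0 < \<phi> (v, u)} \<inter> {u\<in>?I. \<phi> (u, v) < 0} = {}"
      using opposite by blast
    moreover have "(\<Sum>u\<in>{u\<in>?O. 0 < \<phi> (v, u)}. f {v, u}) = ?pO"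
      by (subst sum.inter_filter) (auto simp: f intro!: sum.cong)
    moreover have "(\<Sum>u\<in>{u\<in>?I. \<phi> (u, v) < 0}. f {v, u}) = ?nI"
      by (subst sum.inter_filter) (auto simp: f intro!: sum.cong)
    ultimately have 2: "(\<Sum>w | (v, w) \<in> D'. f {v, w}) = ?pO + ?nI"
      by (simp add: sum.union_disjoint)
    have "(\<Sum>u\<in>?I. \<phi> (u, v)) = ?pI - ?nI" "(\<Sum>w\<in>?O. \<phi> (v, w)) = ?pO - ?nO"
      unfolding sum_subtractf[symmetric] by (auto intro!: sum.cong)
    then show ?thesis
      using bal[OF v] 1 2 by linarith
  qed
  ultimately show ?thesis
    using r unfolding has_circular_nz_flow_def circular_nz_flow_def by blast
qed

section \<open>A reference orientation of the Goldberg snark\<close>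

text \<open>The hexagon \<open>X1 Y1 W1 X2 Y2 W2\<close> is directed cyclically and the claw at
  \<open>W\<close> away from \<open>Z\<close>. Since signed values are allowed, the directions are a
  matter of convenience.\<close>

definition block_arcs :: "(block_vertex \<times> block_vertex) set" where
  "block_arcs = {(Z, W), (W, W1), (W, W2), (X1, Y1), (Y1, W1), (W1, X2), (X2, Y2), (Y2, W2), (W2, X1)}"

definition link_arcs :: "(block_vertex \<times> block_vertex) set" where
  "link_arcs = {(Z, Z), (Y1, X1), (Y2, X2)}"

definition prev_block :: "nat \<Rightarrow> nat \<Rightarrow> nat" where
  "prev_block k t = (if t = 0 then 2 * k else t - 1)"

text \<open>Link arcs are indexed by the block of their head. The cyclic predecessor is given by
  cases, which avoids modular arithmetic in the flow computations.\<close>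

definition goldberg_arcs :: "nat \<Rightarrow> ((nat \<times> block_vertex) \<times> (nat \<times> block_vertex)) set" where
  "goldberg_arcs k =
     (\<lambda>(t, b, c). ((t, b), (t, c))) ` ({..2 * k} \<times> block_arcs) \<union>
     (\<lambda>(t, b, c). ((prev_block k t, b), (t, c))) ` ({..2 * k} \<times> link_arcs)"

lemma prev_block_le: "t \<le> 2 * k \<Longrightarrow> prev_block k t \<le> 2 * k"
  by (auto simp: prev_block_def)

lemma prev_block_eq_iff:
  assumes "s \<le> 2 * k" "t \<le> 2 * k"
  shows "prev_block k t = s \<longleftrightarrow> t = (s + 1) mod (2 * k + 1)"
  using assms by (cases "s = 2 * k") (auto simp: prev_block_def)

lemma image_Times_eq_UN: "f ` (A \<times> B) = (\<Union>a\<in>A. (\<lambda>b. f (a, b)) ` B)"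
  by auto

lemma edges_goldberg_snark:
  "edges (goldberg_snark k) = (\<lambda>(u, v). {u, v}) ` goldberg_arcs k"
proof -
  have block: "block_edges = (\<lambda>(b, c). {b, c}) ` block_arcs"
    by (simp add: block_edges_def block_arcs_def)
  have "(\<Union>t\<in>{0..<2 * k + 1}. (\<lambda>e. Pair t ` e) ` block_edges) =
      (\<lambda>(u, v). {u, v}) ` (\<lambda>(t, b, c). ((t, b), (t, c))) ` ({..2 * k} \<times> block_arcs)"
    by (auto simp: block image_Times_eq_UN image_UN image_image split_def intro!: SUP_cong)
  moreover have "(\<Union>t\<in>{0..<2 * k + 1}. let s = (t + 1) mod (2 * k + 1)
         in {{(t, Z), (s, Z)}, {(t, Y1), (s, X1)}, {(t, Y2), (s, X2)}}) =
      (\<lambda>(u, v). {u, v}) ` (\<lambda>(t, b, c). ((prev_block k t, b), (t, c))) ` ({..2 * k} \<times> link_arcs)"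
    (is "(\<Union>t\<in>_. ?A t) = _")
  proof -
    have A: "?A (prev_block k t) = (\<lambda>(b, c). {(prev_block k t, b), (t, c)}) ` link_arcs"
      if "t \<le> 2 * k" for t
    proof -
      have "(prev_block k t + 1) mod (2 * k + 1) = t"
        using prev_block_eq_iff[OF prev_block_le[OF that] that] by simp
      then show ?thesis by (simp only: Let_def link_arcs_def) simp
    qed
    \<comment> \<open>The snark indexes links by their tail block; as \<open>prev_block k\<close>
      maps the blocks onto themselves, the union can be taken over head blocks.\<close>
    have "{0..<2 * k + 1} = prev_block k ` {..2 * k}"
    proof (intro equalityI subsetI)
      fix s assume "s \<in> {0..<2 * k + 1}"
      then show "s \<in> prev_block k ` {..2 * k}"
        by (intro image_eqI[of _ _ "(s + 1) mod (2 * k + 1)"])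
          (auto simp: prev_block_def mod_Suc)
    qed (auto simp: prev_block_def split: if_splits)
    then have "(\<Union>t\<in>{0..<2 * k + 1}. ?A t) = (\<Union>t\<in>{..2 * k}. ?A (prev_block k t))"
      by simp
    also have "\<dots> = (\<Union>t\<in>{..2 * k}. (\<lambda>(b, c). {(prev_block k t, b), (t, c)}) ` link_arcs)"
      using A by (intro SUP_cong) auto
    finally show ?thesis
      by (simp add: image_Times_eq_UN image_UN image_image split_def)
  qed
  ultimately show ?thesis
    by (simp add: goldberg_snark_def goldberg_arcs_def image_Un)
qed

text \<open>Two arcs over one edge would be antiparallel; with at least three blocks around the
  cycle this cannot happen.\<close>

lemma orientation_goldberg_arcs:
  assumes "1 \<le> k"
  shows "orientation (goldberg_snark k) (goldberg_arcs k)"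
proof -
  have "(v, u) \<notin> goldberg_arcs k" if "(u, v) \<in> goldberg_arcs k" for u v
    using that assms
    by (auto simp: goldberg_arcs_def block_arcs_def link_arcs_def prev_block_def split: if_splits)
  then have "inj_on (\<lambda>(u, v). {u, v}) (goldberg_arcs k)"
    by (auto simp: inj_on_def doubleton_eq_iff)
  moreover have "goldberg_arcs k \<subseteq> verts (goldberg_snark k) \<times> verts (goldberg_snark k)"
    by (auto simp: goldberg_arcs_def goldberg_snark_def prev_block_def)
  ultimately show ?thesis
    by (simp add: orientation_def bij_betw_def edges_goldberg_snark)
qed

lemma mem_goldberg_arcs:
  "((s, b), (t, c)) \<in> goldberg_arcs k \<longleftrightarrow>
     t \<le> 2 * k \<and> (s = t \<and> (b, c) \<in> block_arcs \<or> s = prev_block k t \<and> (b, c) \<in> link_arcs)"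
  by (auto simp: goldberg_arcs_def image_Times_eq_UN)

lemma goldberg_in_neighbours:
  assumes "t \<le> 2 * k"
  shows "{u. (u, (t, c)) \<in> goldberg_arcs k} =
    Pair t ` {b. (b, c) \<in> block_arcs} \<union> Pair (prev_block k t) ` {b. (b, c) \<in> link_arcs}"
  using assms unfolding set_eq_iff split_paired_All by (auto simp: mem_goldberg_arcs)

lemma goldberg_out_neighbours:
  assumes "t \<le> 2 * k"
  shows "{w. ((t, b), w) \<in> goldberg_arcs k} =
    Pair t ` {c. (b, c) \<in> block_arcs} \<union> Pair ((t + 1) mod (2 * k + 1)) ` {c. (b, c) \<in> link_arcs}"
proof -
  have succ: "t = prev_block k s \<and> s \<le> 2 * k \<longleftrightarrow> s = (t + 1) mod (2 * k + 1)" for s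
  proof (cases "s \<le> 2 * k")
    case True
    then show ?thesis using prev_block_eq_iff[OF assms True] by metis
  next
    case False
    moreover have "(t + 1) mod (2 * k + 1) < 2 * k + 1"
      by (rule mod_less_divisor) simp
    ultimately show ?thesis by linarith
  qed
  have Pair_image: "(s, c) \<in> Pair r ` A \<longleftrightarrow> s = r \<and> c \<in> A" for s r :: nat and c :: block_vertex and A
    by auto
  show ?thesis
  proof (rule set_eqI)
    fix w :: "nat \<times> block_vertex"
    obtain s c where w: "w = (s, c)" by (cases w)
    show "w \<in> {w. ((t, b), w) \<in> goldberg_arcs k} \<longleftrightarrow> w \<in> Pair t ` {c. (b, c) \<in> block_arcs} \<union>
        Pair ((t + 1) mod (2 * k + 1)) ` {c. (b, c) \<in> link_arcs}"
      unfolding w mem_Collect_eq mem_goldberg_arcs Un_iff Pair_image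
      using assms succ[of s] by metis
  qed
qed

lemma block_arcs_in:
  "{b. (b, Z) \<in> block_arcs} = {}" "{b. (b, W) \<in> block_arcs} = {Z}"
  "{b. (b, W1) \<in> block_arcs} = {W, Y1}" "{b. (b, W2) \<in> block_arcs} = {W, Y2}"
  "{b. (b, X1) \<in> block_arcs} = {W2}" "{b. (b, X2) \<in> block_arcs} = {W1}"
  "{b. (b, Y1) \<in> block_arcs} = {X1}" "{b. (b, Y2) \<in> block_arcs} = {X2}"
  by (auto simp: block_arcs_def)

lemma block_arcs_out:
  "{c. (Z, c) \<in> block_arcs} = {W}" "{c. (W, c) \<in> block_arcs} = {W1, W2}"
  "{c. (W1, c) \<in> block_arcs} = {X2}" "{c. (W2, c) \<in> block_arcs} = {X1}"
  "{c. (X1, c) \<in> block_arcs} = {Y1}" "{c. (X2, c) \<in> block_arcs} = {Y2}"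
  "{c. (Y1, c) \<in> block_arcs} = {W1}" "{c. (Y2, c) \<in> block_arcs} = {W2}"
  by (auto simp: block_arcs_def)

lemma link_arcs_in:
  "{b. (b, c) \<in> link_arcs} = (case c of Z \<Rightarrow> {Z} | X1 \<Rightarrow> {Y1} | X2 \<Rightarrow> {Y2} | _ \<Rightarrow> {})"
  by (auto simp: link_arcs_def split: block_vertex.splits)

lemma link_arcs_out:
  "{c. (b, c) \<in> link_arcs} = (case b of Z \<Rightarrow> {Z} | Y1 \<Rightarrow> {X1} | Y2 \<Rightarrow> {X2} | _ \<Rightarrow> {})"
  by (auto simp: link_arcs_def split: block_vertex.splits)

lemma sum_Pair_image_Un:
  fixes A B :: "block_vertex set"
  assumes "s \<noteq> t"
  shows "sum g (Pair t ` A \<union> Pair s ` B) = (\<Sum>a\<in>A. g (t, a)) + (\<Sum>b\<in>B. g (s, b))"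
proof -
  have fin: "finite C" for C :: "block_vertex set"
    by (rule finite_subset[OF subset_UNIV]) (simp add: UNIV_block_vertex)
  have "sum g (Pair t ` A \<union> Pair s ` B) = sum g (Pair t ` A) + sum g (Pair s ` B)"
    using assms by (intro sum.union_disjoint finite_imageI fin) auto
  then show ?thesis
    by (simp add: sum.reindex inj_on_def)
qed

section \<open>The flow\<close>

text \<open>
  \<open>goldberg_val n t b c\<close> is the value on the arc from \<open>b\<close> in block \<open>t\<close> to \<open>c\<close>, which lies in
  block \<open>t\<close> for block arcs and in block \<open>t + 1\<close> for link arcs; the pair \<open>(b, c)\<close> tells
  which one is meant.
\<close>

definition arc_val :: "int list \<Rightarrow> block_vertex \<Rightarrow> block_vertex \<Rightarrow> int" where
  "arc_val xs b c = the (map_of (zip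
     [(Z, W), (W, W1), (W, W2), (X1, Y1), (Y1, W1), (W1, X2), (X2, Y2), (Y2, W2), (W2, X1),
      (Z, Z), (Y1, X1), (Y2, X2)] xs) (b, c))"

definition goldberg_val :: "int \<Rightarrow> nat \<Rightarrow> block_vertex \<Rightarrow> block_vertex \<Rightarrow> int" where
  "goldberg_val n t =
     (let j = int ((t + 1) div 2) in arc_val (
       if t = 0 then
         [n, 3*n, -2*n, -2*n, -n, 2*n, n, 3*n, n, n+1, -n, -2*n]
       else if t = 1 then
         [3*n-1, 2*n-1, n, -2*n, n+1, 3*n, n, -2*n, -n, -2*n+2, -3*n-1, 3*n]
       else if t = 2 then
         [-3*n-1, -2*n-1, -n, -n-2, n, -n-1, 2*n-1, 3*n-1, 2*n-1, n+3, -2*n-2, -n]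
       else if odd t then
         [3*n, n, 2*n, -n-j, -2*n-j, -n-j, -2*n-j, -n, n, -2*n+j+1, n, -n-j]
       else
         [-3*n-1, -2*n-1, -n, -n-j, n+1, -n, -2*n-j, -n-j, -2*n-j, n+j+2, -2*n-j-1, -n]))"

text \<open>Divided by \<open>n\<close>, these bounds become 1 and \<open>3 + 1/n\<close>, which is
  \<open>r - 1\<close> for \<open>r = 4 + 1/(k + 1)\<close>.\<close>

lemma goldberg_val_bounds:
  assumes "1 \<le> k" "t \<le> 2 * k" "(b, c) \<in> block_arcs \<union> link_arcs" "n = int k + 1"
  shows "n \<le> \<bar>goldberg_val n t b c\<bar>" "\<bar>goldberg_val n t b c\<bar> \<le> 3 * n + 1"
proof -
  define j where "j = int ((t + 1) div 2)"
  \<comment> \<open>Both bounds are sharp for the estimate: \<open>-2*n+j+1\<close> has modulus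
    exactly \<open>n\<close> at \<open>j = n - 1\<close>, and \<open>-2*n+2\<close> in block 1 needs
    \<open>2 \<le> n\<close>.\<close>
  have j: "0 \<le> j" "j \<le> n - 1" and "2 \<le> n"
    using assms by (auto simp: j_def)
  note g = goldberg_val_def[of n t, unfolded Let_def, folded j_def]
  consider "t = 0" | "t = 1" | "t = 2" | "2 < t" "odd t" | "2 < t" "even t"
    by linarith
  then have "n \<le> \<bar>goldberg_val n t b c\<bar> \<and> \<bar>goldberg_val n t b c\<bar> \<le> 3 * n + 1"
    unfolding g by cases (use j \<open>2 \<le> n\<close> assms(3) in
      \<open>auto simp: arc_val_def block_arcs_def link_arcs_def\<close>)
  then show "n \<le> \<bar>goldberg_val n t b c\<bar>" "\<bar>goldberg_val n t b c\<bar> \<le> 3 * n + 1"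
    by auto
qed

text \<open>Conservation at \<open>W\<close>, \<open>W1\<close>, \<open>W2\<close>,
  \<open>Y1\<close>, \<open>Y2\<close>, the vertices without an incoming link; it involves one block
  only.\<close>

lemma goldberg_val_balance_inner:
  fixes n t
  defines "g \<equiv> goldberg_val n t"
  shows "g Z W = g W W1 + g W W2" "g W W1 + g Y1 W1 = g W1 X2" "g W W2 + g Y2 W2 = g W2 X1"
    "g X1 Y1 = g Y1 W1 + g Y1 X1" "g X2 Y2 = g Y2 W2 + g Y2 X2"
  by (auto simp: g_def goldberg_val_def arc_val_def Let_def)

text \<open>Conservation at \<open>Z\<close>, \<open>X1\<close>, \<open>X2\<close>, where a link
  arrives from the previous block.\<close>

lemma goldberg_val_balance_links:
  fixes k t
  assumes "1 \<le> k" "t \<le> 2 * k" and n: "n = int k + 1"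
  defines "g \<equiv> goldberg_val n t" and "h \<equiv> goldberg_val n (prev_block k t)"
  shows "h Z Z = g Z W + g Z Z" "g W2 X1 + h Y1 X1 = g X1 Y1" "g W1 X2 + h Y2 X2 = g X2 Y2"
proof -
  have "h Z Z = g Z W + g Z Z \<and> g W2 X1 + h Y1 X1 = g X1 Y1 \<and> g W1 X2 + h Y2 X2 = g X2 Y2"
  proof -
    \<comment> \<open>From block 4 on, a block and its predecessor both follow the affine pattern:
      an even block shares \<open>j\<close> with its predecessor, an odd block has \<open>j\<close>
      larger by one. Block 3 still follows the special block 2.\<close>
    have "t \<in> {0, 1, 2, 3} \<or> (\<exists>i. t = 2 * i + 4) \<or> (\<exists>i. t = 2 * i + 5)"
      by simp presburger
    then consider "t = 0" | "t = 1" | "t = 2" | "t = 3" | i where "t = 2 * i + 4" | i where "t = 2 * i + 5"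
      by blast
    then show ?thesis
    proof cases
      case 1
      \<comment> \<open>The cycle closes here. The predecessor \<open>2 * k\<close> is the special
        block 2 if \<open>k = 1\<close>, and otherwise an even block with \<open>j = n - 1\<close>;
        in both cases its outgoing links carry \<open>2*n+1\<close>, \<open>-3*n\<close>,
        \<open>-n\<close>.\<close>
      then show ?thesis using assms
        by (cases "k = 1") (auto simp: g_def h_def goldberg_val_def arc_val_def prev_block_def Let_def)
    qed (use n in \<open>auto simp: g_def h_def goldberg_val_def arc_val_def prev_block_def Let_def\<close>)
  qed
  then show "h Z Z = g Z W + g Z Z" "g W2 X1 + h Y1 X1 = g X1 Y1" "g W1 X2 + h Y2 X2 = g X2 Y2"
    by auto
qed

theorem proposition4p3:
  fixes k :: nat
  assumes "k \<ge> 1"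
  shows "circular_flow_number (goldberg_snark k) \<le> 4 + 1 / (real k + 1)"
proof (rule circular_flow_number_le[OF fin_simple_goldberg_snark[OF assms]])
  define n where "n = int k + 1"
  have n: "real_of_int n = real k + 1" "0 < n" by (simp_all add: n_def)
  define \<phi> where "\<phi> = (\<lambda>((t, b), (s :: nat, c)). real_of_int (goldberg_val n t b c) / real_of_int n)"
  show "has_circular_nz_flow (goldberg_snark k) (4 + 1 / (real k + 1))"
  proof (rule has_circular_nz_flow_signed[OF _ orientation_goldberg_arcs[OF assms], of _ \<phi>])
    show "finite (verts (goldberg_snark k))"
      using fin_simple_goldberg_snark[OF assms] by (simp add: fin_simple_graph_def)
    show "2 \<le> 4 + 1 / (real k + 1)"
      by (simp add: add_increasing2)
  next
    fix a assume "a \<in> goldberg_arcs k"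
    then obtain t b s c where a: "a = ((t, b), (s, c))" "t \<le> 2 * k" "(b, c) \<in> block_arcs \<union> link_arcs"
      by (auto simp: goldberg_arcs_def prev_block_le)
    let ?x = "real_of_int \<bar>goldberg_val n t b c\<bar>"
    have "real_of_int n \<le> ?x" "?x \<le> real_of_int (3 * n + 1)"
      using goldberg_val_bounds[OF assms a(2,3) n_def] by (simp_all only: of_int_le_iff)
    moreover have abs: "\<bar>\<phi> a\<bar> = ?x / real_of_int n"
      using n by (simp add: a \<phi>_def)
    ultimately show "1 \<le> \<bar>\<phi> a\<bar> \<and> \<bar>\<phi> a\<bar> \<le> 4 + 1 / (real k + 1) - 1"
      using n(2) unfolding abs n(1)[symmetric] by (simp add: field_simps)
  next
    fix v assume "v \<in> verts (goldberg_snark k)"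
    then obtain t b where v: "v = (t, b)" and t: "t \<le> 2 * k"
      by (auto simp: goldberg_snark_def)
    let ?G = "goldberg_val n"
    have ne: "prev_block k t \<noteq> t" "(t + 1) mod (2 * k + 1) \<noteq> t"
      using assms t goldberg_succ_neq by (auto simp: prev_block_def)
    have "(\<Sum>u | (u, v) \<in> goldberg_arcs k. \<phi> (u, v)) =
        real_of_int ((\<Sum>a | (a, b) \<in> block_arcs. ?G t a b) +
          (\<Sum>a | (a, b) \<in> link_arcs. ?G (prev_block k t) a b)) / real_of_int n"
      unfolding v goldberg_in_neighbours[OF t] sum_Pair_image_Un[OF ne(1)]
      by (simp add: \<phi>_def sum_divide_distrib add_divide_distrib)
    moreover have "(\<Sum>w | (v, w) \<in> goldberg_arcs k. \<phi> (v, w)) =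
        real_of_int ((\<Sum>c | (b, c) \<in> block_arcs. ?G t b c) +
          (\<Sum>c | (b, c) \<in> link_arcs. ?G t b c)) / real_of_int n"
      unfolding v goldberg_out_neighbours[OF t] sum_Pair_image_Un[OF ne(2)]
      by (simp add: \<phi>_def sum_divide_distrib add_divide_distrib)
    \<comment> \<open>Values are stored with the tail block, hence incoming links are read off at
      \<open>prev_block k t\<close>. The eight vertices are exactly those of the two balance
      lemmas.\<close>
    moreover have "(\<Sum>a | (a, b) \<in> block_arcs. ?G t a b) +
          (\<Sum>a | (a, b) \<in> link_arcs. ?G (prev_block k t) a b) =
        (\<Sum>c | (b, c) \<in> block_arcs. ?G t b c) + (\<Sum>c | (b, c) \<in> link_arcs. ?G t b c)"
      using goldberg_val_balance_inner[of n t] goldberg_val_balance_links[OF assms t n_def]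
      by (cases b) (simp_all add: block_arcs_in block_arcs_out link_arcs_in link_arcs_out)
    ultimately show "(\<Sum>u | (u, v) \<in> goldberg_arcs k. \<phi> (u, v)) =
        (\<Sum>w | (v, w) \<in> goldberg_arcs k. \<phi> (v, w))"
      by simp
  qed
qed

end
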